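(* $[\tau(\mathbf{CInd})\mathbf{Txt}\mathbf{Sd}\mathbf{Ex}_C]_{\mathbf{REC}} \setminus [\mathbf{Txt}\mathbf{It}\mathbf{Ex}_W]_{\mathbf{REC}} \neq \emptyset$.
   Context: Fix an acceptable numbering $(\varphi_e)_{e\in\mathbb{N}}$ of all partial computable functions. $W_e=\mathrm{dom}(\varphi_e)$. A number $e$ is a $C$-index if $\varphi_e$ is total with values in $\{0,1\}$; then $C_e=\{x:\varphi_e(x)=1\}$. $\mathbf{REC}$ is the collection of recursive subsets of $\mathbb{N}$; $\mathcal{P}$ denotes the partial computable functions. Fix a pause symbol $\#$. A text is a total function $T:\mathbb{N}\to\mathbb{N}\cup\{\#\}$, $\mathrm{content}(T)=\mathrm{range}(T)\setminus\{\#\}$, $T$ is a text for $L$ if $\mathrm{content}(T)=L$, $T[n]=(T(0),\dots,T(n-1))$. A learner is some $h\in\mathcal{P}$. Hypothesis sequences: set-driven $\mathbf{Sd}(h,T)(i)=h(\mathrm{content}(T[i]))$; iterative $\mathbf{It}(h,T)(0)=h(\varepsilon)$ and $\mathbf{It}(h,T)(i)=h(\mathbf{It}(h,T)(i-1),T(i-1))$ for $i>0$. Restrictions on hypothesis sequence $p$ and text $T$: $\mathbf{Ex}_C$: there is $n_0$ with $p(n)=p(n_0)$ for all $n\ge n_0$ and $p(n_0)$ a $C$-index with $C_{p(n_0)}=\mathrm{content}(T)$; $\mathbf{Ex}_W$: same but with $W_{p(n_0)}=\mathrm{content}(T)$; $\mathbf{CInd}$: for all $i$, $p(i)$ is a $C$-index.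 A learner $h$ $\tau(\alpha)\mathbf{Txt}\beta\delta$-learns $L$ iff $\alpha(\beta(h,T),T)$ holds for every text $T$ whatsoever and $\delta(\beta(h,T),T)$ holds for every text $T$ for $L$ (omitting $\tau(\alpha)$ means no global requirement). $[\tau(\alpha)\mathbf{Txt}\beta\delta]_{\mathbf{REC}}$ is the set of all classes $\mathcal{L}\subseteq\mathbf{REC}$ for which some $h\in\mathcal{P}$ learns every $L\in\mathcal{L}$ in this sense. *)

theory Defs
  imports Main "HOL-Library.Nat_Bijection"
begin

section \<open>Partial computable functions\<close>

text \<open>
  Kleene's $\mu$-recursive partial functions: \<open>partial_recursive n f\<close> says that \<open>f\<close> is one of
  arity \<open>n\<close>. Only the values of \<open>f\<close> on lists of length \<open>n\<close> matter; the value \<^term>\<open>None\<close>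
  means divergence.
\<close>

inductive partial_recursive :: "nat \<Rightarrow> (nat list \<Rightarrow> nat option) \<Rightarrow> bool" where
  zero: "partial_recursive n (\<lambda>xs. Some 0)"
| succ: "partial_recursive 1 (\<lambda>xs. Some (Suc (hd xs)))"
| proj: "i < n \<Longrightarrow> partial_recursive n (\<lambda>xs. Some (xs ! i))"
| comp: "partial_recursive (length fs) g \<Longrightarrow> \<forall>f \<in> set fs. partial_recursive n f \<Longrightarrow>
    partial_recursive n
      (\<lambda>xs. if \<forall>f \<in> set fs. f xs \<noteq> None then g (map (\<lambda>f. the (f xs)) fs) else None)"
| prim_rec: "partial_recursive n f \<Longrightarrow> partial_recursive (Suc (Suc n)) g \<Longrightarrow>
    partial_recursive (Suc n)
      (\<lambda>xs. rec_nat (f (tl xs)) (\<lambda>y r. Option.bind r (\<lambda>v. g (y # v # tl xs))) (hd xs))"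
| mu: "partial_recursive (Suc n) g \<Longrightarrow>
    partial_recursive n
      (\<lambda>xs. if \<exists>y. g (y # xs) = Some 0 \<and> (\<forall>z<y. g (z # xs) \<noteq> None)
            then Some (LEAST y. g (y # xs) = Some 0) else None)"

definition partial_computable :: "(nat \<Rightarrow> nat option) \<Rightarrow> bool" where
  "partial_computable f \<longleftrightarrow> (\<exists>F. partial_recursive 1 F \<and> (\<forall>x. f x = F [x]))"

definition partial_computable2 :: "(nat \<Rightarrow> nat \<Rightarrow> nat option) \<Rightarrow> bool" where
  "partial_computable2 f \<longleftrightarrow> (\<exists>F. partial_recursive 2 F \<and> (\<forall>x y. f x y = F [x, y]))"

definition total_computable :: "(nat \<Rightarrow> nat) \<Rightarrow> bool" where
  "total_computable f \<longleftrightarrow> partial_computable (\<lambda>x. Some (f x))"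

text \<open>
  Acceptability in the sense of Rogers: \<open>\<phi>\<close> is uniformly partial computable, and every uniformly
  partial computable sequence of functions translates computably into \<open>\<phi>\<close>. Constant sequences
  show that \<open>\<phi>\<close> then enumerates all partial computable functions.
\<close>

definition acceptable_numbering :: "(nat \<Rightarrow> nat \<Rightarrow> nat option) \<Rightarrow> bool" where
  "acceptable_numbering \<phi> \<longleftrightarrow> partial_computable2 \<phi> \<and>
     (\<forall>\<psi>. partial_computable2 \<psi> \<longrightarrow>
        (\<exists>s. total_computable s \<and> (\<forall>e x. \<psi> e x = \<phi> (s e) x)))"

definition REC :: "nat set set" where
  "REC = {A. total_computable (\<lambda>x. if x \<in> A then 1 else 0)}"

definition W_set :: "(nat \<Rightarrow> nat \<Rightarrow> nat option) \<Rightarrow> nat \<Rightarrow> nat set" where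
  "W_set \<phi> e = dom (\<phi> e)"

definition C_index :: "(nat \<Rightarrow> nat \<Rightarrow> nat option) \<Rightarrow> nat \<Rightarrow> bool" where
  "C_index \<phi> e \<longleftrightarrow> (\<forall>x. \<phi> e x \<in> {Some 0, Some 1})"

definition C_set :: "(nat \<Rightarrow> nat \<Rightarrow> nat option) \<Rightarrow> nat \<Rightarrow> nat set" where
  "C_set \<phi> e = {x. \<phi> e x = Some 1}"


section \<open>Texts and learners\<close>

text \<open>The pause symbol is \<^term>\<open>None\<close>, a datum \<open>x\<close> is \<^term>\<open>Some x\<close>.\<close>

type_synonym text_seq = "nat \<Rightarrow> nat option"

text \<open>A hypothesis is \<^term>\<open>None\<close> where the learner diverges.\<close>

type_synonym hyp_seq = "nat \<Rightarrow> nat option"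
type_synonym learner = "nat \<Rightarrow> nat option"
type_synonym interaction = "learner \<Rightarrow> text_seq \<Rightarrow> hyp_seq"
type_synonym restriction = "hyp_seq \<Rightarrow> text_seq \<Rightarrow> bool"

definition content :: "text_seq \<Rightarrow> nat set" where
  "content T = {x. Some x \<in> range T}"

definition text_for :: "text_seq \<Rightarrow> nat set \<Rightarrow> bool" where
  "text_for T L \<longleftrightarrow> content T = L"

definition initial :: "text_seq \<Rightarrow> nat \<Rightarrow> nat option list" where
  "initial T n = map T [0..<n]"

definition list_content :: "nat option list \<Rightarrow> nat set" where
  "list_content \<sigma> = {x. Some x \<in> set \<sigma>}"

text \<open>
  Learners are functions on numbers, so their inputs are coded: finite sets by
  \<^const>\<open>set_encode\<close>, finite sequences by \<^const>\<open>list_encode\<close>, and elements of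
  $N \cup \{\#\}$ as follows.
\<close>

definition datum_encode :: "nat option \<Rightarrow> nat" where
  "datum_encode d = (case d of None \<Rightarrow> 0 | Some x \<Rightarrow> Suc x)"

definition Sd :: interaction where
  "Sd h T i = h (set_encode (list_content (initial T i)))"

primrec It :: interaction where
  "It h T 0 = h (list_encode [])"
| "It h T (Suc i) = Option.bind (It h T i) (\<lambda>e. h (list_encode [e, datum_encode (T i)]))"


section \<open>Learning criteria\<close>

definition Ex_C :: "(nat \<Rightarrow> nat \<Rightarrow> nat option) \<Rightarrow> restriction" where
  "Ex_C \<phi> p T \<longleftrightarrow> (\<exists>n\<^sub>0 e. (\<forall>n\<ge>n\<^sub>0. p n = p n\<^sub>0) \<and> p n\<^sub>0 = Some e \<and>
     C_index \<phi> e \<and> C_set \<phi> e = content T)"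

definition Ex_W :: "(nat \<Rightarrow> nat \<Rightarrow> nat option) \<Rightarrow> restriction" where
  "Ex_W \<phi> p T \<longleftrightarrow> (\<exists>n\<^sub>0 e. (\<forall>n\<ge>n\<^sub>0. p n = p n\<^sub>0) \<and> p n\<^sub>0 = Some e \<and>
     W_set \<phi> e = content T)"

definition CInd :: "(nat \<Rightarrow> nat \<Rightarrow> nat option) \<Rightarrow> restriction" where
  "CInd \<phi> p T \<longleftrightarrow> (\<forall>i. \<exists>e. p i = Some e \<and> C_index \<phi> e)"

text \<open>The absence of a restriction.\<close>

definition Unrestricted :: restriction where
  "Unrestricted p T \<longleftrightarrow> True"

definition learns ::
  "restriction \<Rightarrow> interaction \<Rightarrow> restriction \<Rightarrow> learner \<Rightarrow> nat set \<Rightarrow> bool" where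
  "learns \<alpha> \<beta> \<delta> h L \<longleftrightarrow>
     (\<forall>T. \<alpha> (\<beta> h T) T) \<and> (\<forall>T. text_for T L \<longrightarrow> \<delta> (\<beta> h T) T)"

text \<open>\<open>learnable_REC \<alpha> \<beta> \<delta>\<close> is $[\tau(\alpha)\mathbf{Txt}\beta\delta]_{\mathbf{REC}}$.\<close>

definition learnable_REC ::
  "restriction \<Rightarrow> interaction \<Rightarrow> restriction \<Rightarrow> nat set set set" where
  "learnable_REC \<alpha> \<beta> \<delta> =
     {\<L>. \<L> \<subseteq> REC \<and> (\<exists>h. partial_computable h \<and> (\<forall>L\<in>\<L>. learns \<alpha> \<beta> \<delta> h L))}"

end

theory Submission
  imports Defs
begin

text \<open>
  The separating class consists of the set of positive numbers and all finite sets containing 0.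
  A set-driven learner conjectures the positive numbers until 0 appears, and from then on exactly
  the finite set seen so far. An iterative learner, fed 1, 2, 3, \dots, must settle on some
  hypothesis after n steps, so it cannot remember whether n + 1 was shown as well; continuing with
  0, 0, \dots{} makes it confuse \<open>{0..n}\<close> with \<open>{0..n+1}\<close>.
\<close>

section \<open>Total recursive functions\<close>

text \<open>Restricting to total functions keeps \<open>option\<close> out of the closure lemmas.
  Agreement is asked only at length \<open>n\<close>, because the values of \<open>F\<close> on
  other lists carry no meaning.\<close>

definition recursive :: "nat \<Rightarrow> (nat list \<Rightarrow> nat) \<Rightarrow> bool" where
  "recursive n f \<longleftrightarrow> (\<exists>F. partial_recursive n F \<and> (\<forall>xs. length xs = n \<longrightarrow> F xs = Some (f xs)))"

lemma recursiveI:
  "partial_recursive n F \<Longrightarrow> (\<And>xs. length xs = n \<Longrightarrow> F xs = Some (f xs)) \<Longrightarrow> recursive n f"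
  unfolding recursive_def by blast

lemma recursive_zero: "recursive n (\<lambda>xs. 0)"
  unfolding recursive_def using partial_recursive.zero by blast

lemma recursive_proj: "i < n \<Longrightarrow> recursive n (\<lambda>xs. xs ! i)"
  unfolding recursive_def using partial_recursive.proj by blast

text \<open>With \<open>g\<close> an ordinary function on numbers, each operation below has to be
  derived only for plain arguments \<open>xs ! 0\<close>, \<open>xs ! 1\<close>; substitution then
  extends it to arbitrary recursive arguments.\<close>

lemma recursive_comp1:
  assumes "recursive 1 (\<lambda>xs. g (xs ! 0))" "recursive n f"
  shows "recursive n (\<lambda>xs. g (f xs))"
proof -
  obtain G F where G: "partial_recursive 1 G" "\<And>xs. length xs = 1 \<Longrightarrow> G xs = Some (g (xs ! 0))"
    and F: "partial_recursive n F" "\<And>xs. length xs = n \<Longrightarrow> F xs = Some (f xs)"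
    using assms unfolding recursive_def by blast
  have "partial_recursive n
      (\<lambda>xs. if \<forall>f \<in> set [F]. f xs \<noteq> None then G (map (\<lambda>f. the (f xs)) [F]) else None)"
    using G F by (intro partial_recursive.comp) auto
  then show ?thesis
    by (rule recursiveI) (auto simp: F G)
qed

lemma recursive_comp2:
  assumes "recursive 2 (\<lambda>xs. g (xs ! 0) (xs ! 1))" "recursive n f1" "recursive n f2"
  shows "recursive n (\<lambda>xs. g (f1 xs) (f2 xs))"
proof -
  obtain G F1 F2
    where G: "partial_recursive 2 G" "\<And>xs. length xs = 2 \<Longrightarrow> G xs = Some (g (xs ! 0) (xs ! 1))"
      and F: "partial_recursive n F1" "\<And>xs. length xs = n \<Longrightarrow> F1 xs = Some (f1 xs)"
        "partial_recursive n F2" "\<And>xs. length xs = n \<Longrightarrow> F2 xs = Some (f2 xs)"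
    using assms unfolding recursive_def by blast
  have "partial_recursive n
      (\<lambda>xs. if \<forall>f \<in> set [F1, F2]. f xs \<noteq> None
        then G (map (\<lambda>f. the (f xs)) [F1, F2]) else None)"
    using G F by (intro partial_recursive.comp) (auto simp: numeral_2_eq_2)
  then show ?thesis
    by (rule recursiveI) (auto simp: F G)
qed

lemma recursive_Suc: "recursive n f \<Longrightarrow> recursive n (\<lambda>xs. Suc (f xs))"
proof (rule recursive_comp1[where g = "Suc"])
  show "recursive 1 (\<lambda>xs. Suc (xs ! 0))"
    by (rule recursiveI[OF partial_recursive.succ]) (auto simp: length_Suc_conv)
qed

lemma recursive_const: "recursive n (\<lambda>xs. c)"
  by (induction c) (auto intro: recursive_zero recursive_Suc)

text \<open>Any \<open>h\<close> satisfying the recursion equations qualifies, so no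
  \<open>rec_nat\<close> term has to be exhibited. In \<open>g\<close>, entry 0 is the counter,
  entry 1 the previous value, and the parameters start at entry 2.\<close>

lemma recursive_prim_rec:
  assumes "recursive n f" "recursive (Suc (Suc n)) g"
    and h0: "\<And>xs. length xs = n \<Longrightarrow> h (0 # xs) = f xs"
    and hSuc: "\<And>y xs. length xs = n \<Longrightarrow> h (Suc y # xs) = g (y # h (y # xs) # xs)"
  shows "recursive (Suc n) h"
proof -
  obtain F G where F: "partial_recursive n F" "\<And>xs. length xs = n \<Longrightarrow> F xs = Some (f xs)"
    and G: "partial_recursive (Suc (Suc n)) G"
      "\<And>xs. length xs = Suc (Suc n) \<Longrightarrow> G xs = Some (g xs)"
    using assms(1,2) unfolding recursive_def by blast
  have "rec_nat (F xs) (\<lambda>y r. Option.bind r (\<lambda>v. G (y # v # xs))) y = Some (h (y # xs))"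
    if "length xs = n" for xs y
    using that by (induction y) (auto simp: F G h0 hSuc)
  then show ?thesis
    by (intro recursiveI[OF partial_recursive.prim_rec[OF F(1) G(1)]]) (auto simp: length_Suc_conv)
qed

lemma total_computable_iff: "total_computable f \<longleftrightarrow> recursive 1 (\<lambda>xs. f (xs ! 0))"
proof -
  have "(\<forall>x. Some (f x) = F [x]) \<longleftrightarrow> (\<forall>xs. length xs = 1 \<longrightarrow> F xs = Some (f (xs ! 0)))" for F
  proof (intro iffI allI impI)
    fix xs :: "nat list"
    assume F: "\<forall>x. Some (f x) = F [x]" and "length xs = 1"
    then obtain x where "xs = [x]"
      by (auto simp: length_Suc_conv)
    then show "F xs = Some (f (xs ! 0))"
      using F[rule_format, of x] by simp
  qed simp
  then show ?thesis
    unfolding total_computable_def partial_computable_def recursive_def by simp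
qed

lemma partial_computable2_Some:
  assumes "recursive 2 (\<lambda>xs. f (xs ! 0) (xs ! 1))"
  shows "partial_computable2 (\<lambda>x y. Some (f x y))"
proof -
  obtain F where "partial_recursive 2 F"
    "\<And>xs. length xs = 2 \<Longrightarrow> F xs = Some (f (xs ! 0) (xs ! 1))"
    using assms unfolding recursive_def by blast
  then show ?thesis
    unfolding partial_computable2_def by (intro exI[of _ F]) auto
qed

section \<open>Arithmetic for deciding membership in coded finite sets\<close>

lemma recursive_is_zero: "recursive n f \<Longrightarrow> recursive n (\<lambda>xs. of_bool (f xs = 0))"
proof (rule recursive_comp1[where g = "\<lambda>x. of_bool (x = 0)"])
  show "recursive 1 (\<lambda>xs. of_bool (xs ! 0 = 0))"
    unfolding One_nat_def
    by (rule recursive_prim_rec[where f = "\<lambda>xs. 1" and g = "\<lambda>xs. 0"])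
      (auto intro: recursive_const)
qed

lemma recursive_add: "recursive n f \<Longrightarrow> recursive n g \<Longrightarrow> recursive n (\<lambda>xs. f xs + g xs)"
proof (rule recursive_comp2[where g = "(+)"])
  show "recursive 2 (\<lambda>xs. xs ! 0 + xs ! 1)"
    unfolding numeral_2_eq_2
    by (rule recursive_prim_rec[where f = "\<lambda>xs. xs ! 0" and g = "\<lambda>xs. Suc (xs ! 1)"])
      (auto intro: recursive_proj recursive_Suc)
qed

lemma recursive_mod_2: "recursive n f \<Longrightarrow> recursive n (\<lambda>xs. f xs mod 2)"
proof (rule recursive_comp1[where g = "\<lambda>x. x mod 2"])
  show "recursive 1 (\<lambda>xs. xs ! 0 mod 2)"
    unfolding One_nat_def
    \<comment> \<open>Parity flips at each successor, and on bits the zero test is negation.\<close>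
    by (rule recursive_prim_rec[where f = "\<lambda>xs. 0" and g = "\<lambda>xs. of_bool (xs ! 1 = 0)"])
      (auto intro: recursive_const recursive_is_zero recursive_proj simp: mod_Suc)
qed

lemma recursive_div_2: "recursive n f \<Longrightarrow> recursive n (\<lambda>xs. f xs div 2)"
proof (rule recursive_comp1[where g = "\<lambda>x. x div 2"])
  show "recursive 1 (\<lambda>xs. xs ! 0 div 2)"
    unfolding One_nat_def
  proof (rule recursive_prim_rec[where f = "\<lambda>xs. 0" and g = "\<lambda>xs. xs ! 1 + xs ! 0 mod 2"])
    \<comment> \<open>The quotient grows exactly when the counter \<open>y\<close> is odd.\<close>
    have "Suc y div 2 = y div 2 + y mod 2" for y
      by presburger
    then show "(Suc y # xs) ! 0 div 2 =
        (y # (y # xs) ! 0 div 2 # xs) ! 1 + (y # (y # xs) ! 0 div 2 # xs) ! 0 mod 2" for y xs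
      by (metis One_nat_def nth_Cons_0 nth_Cons_Suc)
    show "recursive (Suc (Suc 0)) (\<lambda>xs. xs ! 1 + xs ! 0 mod 2)"
      by (intro recursive_add recursive_mod_2 recursive_proj) simp_all
  qed (auto intro: recursive_const)
qed

lemma recursive_if_zero:
  "recursive n f \<Longrightarrow> recursive n g \<Longrightarrow> recursive n (\<lambda>xs. if f xs = 0 then 0 else g xs)"
proof (rule recursive_comp2[where g = "\<lambda>x y. if x = 0 then 0 else y"])
  show "recursive 2 (\<lambda>xs. if xs ! 0 = 0 then 0 else xs ! 1)"
    unfolding numeral_2_eq_2
    \<comment> \<open>Recursion serves as a case split: the successor step ignores the previous
      value and returns the parameter.\<close>
    by (rule recursive_prim_rec[where f = "\<lambda>xs. 0" and g = "\<lambda>xs. xs ! 2"])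
      (auto intro: recursive_const recursive_proj)
qed

text \<open>A number \<open>x\<close> belongs to the set coded by \<open>m\<close> iff bit
  \<open>x\<close> of \<open>m\<close> is 1: halve \<open>m\<close> \<open>x\<close> times and take
  the parity.\<close>

lemma recursive_mem_set_decode:
  assumes "recursive n f" "recursive n g"
  shows "recursive n (\<lambda>xs. of_bool (f xs \<in> set_decode (g xs)))"
proof -
  have "recursive (Suc 1) (\<lambda>xs. xs ! 1 div 2 ^ (xs ! 0))"
    by (rule recursive_prim_rec[where f = "\<lambda>xs. xs ! 0" and g = "\<lambda>xs. xs ! 1 div 2"])
      (auto intro: recursive_div_2 recursive_proj simp: div_mult2_eq power_Suc2 simp del: power_Suc)
  then have "recursive 2 (\<lambda>xs. xs ! 1 div 2 ^ (xs ! 0))"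
    by (simp add: numeral_2_eq_2)
  from recursive_mod_2[OF recursive_comp2[OF this assms]]
  show ?thesis
    by (simp add: set_decode_def of_bool_odd_eq_mod_2)
qed


section \<open>The separating class\<close>

definition separating_class :: "nat set set" where
  "separating_class = insert {0<..} {L. finite L \<and> 0 \<in> L}"

text \<open>Code 0, which would denote the empty set, is free to denote the positive numbers.\<close>

definition language :: "nat \<Rightarrow> nat set" where
  "language e = (if e = 0 then {0<..} else set_decode e)"

text \<open>Decidability must be uniform in the code, since acceptability translates only uniformly
  computable families into \<open>\<phi>\<close>.\<close>

lemma recursive_language: "recursive 2 (\<lambda>xs. of_bool (xs ! 1 \<in> language (xs ! 0)))"
proof -
  \<comment> \<open>The first summand tests \<open>e = 0\<close> and \<open>x \<noteq> 0\<close> at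
    once. The summands are never both 1, because \<open>set_decode 0\<close> is empty.\<close>
  have eq: "of_bool (x \<in> language e) =
      (of_bool (e + of_bool (x = 0) = 0) + of_bool (x \<in> set_decode e) :: nat)" for x e
    by (auto simp: language_def)
  show ?thesis
    unfolding eq
    by (intro recursive_add recursive_is_zero recursive_mem_set_decode recursive_proj) auto
qed

lemma language_in_REC: "language e \<in> REC"
proof -
  have "recursive 1 (\<lambda>xs. of_bool (xs ! 0 \<in> language e))"
    by (rule recursive_comp2[OF recursive_language recursive_const recursive_proj]) simp
  then show ?thesis
    by (simp add: REC_def total_computable_iff of_bool_def)
qed

text \<open>A set containing 0 is nonempty, so its code avoids the reserved code 0.\<close>

lemma language_set_encode:
  assumes "finite L" "0 \<in> L"
  shows "language (set_encode L) = L"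
proof -
  have "set_decode (set_encode L) = L"
    by (rule set_encode_inverse[OF assms(1)])
  moreover from this have "set_encode L \<noteq> 0"
    using assms(2) by (metis empty_iff set_decode_zero)
  ultimately show ?thesis
    by (simp add: language_def)
qed

lemma separating_class_subset_REC: "separating_class \<subseteq> REC"
proof
  fix L assume "L \<in> separating_class"
  then consider "L = {0<..}" | "finite L" "0 \<in> L"
    by (auto simp: separating_class_def)
  then show "L \<in> REC"
  proof cases
    case 1
    then show ?thesis
      using language_in_REC[of 0] by (simp add: language_def)
  next
    case 2
    then show ?thesis
      using language_in_REC[of "set_encode L"] by (simp add: language_set_encode)
  qed
qed

section \<open>Set-driven learning of the class\<close>

lemma finite_list_content: "finite (list_content \<sigma>)"
proof -
  have "list_content \<sigma> \<subseteq> the ` set \<sigma>"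
    by (force simp: list_content_def)
  then show ?thesis
    by (rule finite_subset) simp
qed

lemma mem_content: "x \<in> content T \<longleftrightarrow> (\<exists>j. T j = Some x)"
  by (auto simp: content_def image_iff eq_commute[of "Some x"])

lemma mem_list_content_initial: "x \<in> list_content (initial T i) \<longleftrightarrow> (\<exists>j<i. T j = Some x)"
  by (auto simp: list_content_def initial_def image_iff Bex_def eq_commute[of "Some x"])

text \<open>Choose one position for each element; finitely many positions have a common
  bound.\<close>

lemma list_content_initial_eventually:
  assumes "finite (content T)"
  shows "\<exists>n. \<forall>i\<ge>n. list_content (initial T i) = content T"
proof -
  have "\<forall>x\<in>content T. \<exists>j. T j = Some x"
    by (simp add: mem_content)
  then obtain pos where pos: "\<And>x. x \<in> content T \<Longrightarrow> T (pos x) = Some x"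
    by metis
  obtain n where n: "\<forall>x\<in>content T. pos x < n"
    using assms by (metis finite_imageI finite_nat_set_iff_bounded image_eqI)
  have "list_content (initial T i) = content T" if "i \<ge> n" for i
  proof
    show "list_content (initial T i) \<subseteq> content T"
      by (auto simp: mem_list_content_initial mem_content)
    show "content T \<subseteq> list_content (initial T i)"
      unfolding mem_list_content_initial subset_eq using n that pos by (meson less_le_trans)
  qed
  then show ?thesis by blast
qed

lemma separating_class_Sd_learnable:
  assumes "acceptable_numbering \<phi>"
  shows "separating_class \<in> learnable_REC (CInd \<phi>) Sd (Ex_C \<phi>)"
proof -
  have "partial_computable2 (\<lambda>e x. Some (of_bool (x \<in> language e)))"
    using recursive_language by (rule partial_computable2_Some)
  \<comment> \<open>Every value of \<open>s\<close> is a C-index, so a learner that outputs only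
    such values satisfies \<open>CInd\<close> on all texts, whatever their content.\<close>
  then have "\<exists>s. total_computable s \<and> (\<forall>e x. Some (of_bool (x \<in> language e)) = \<phi> (s e) x)"
    using assms unfolding acceptable_numbering_def by (elim conjE allE impE)
  then obtain s where s: "total_computable s"
    and \<phi>: "\<And>e x. \<phi> (s e) x = Some (of_bool (x \<in> language e))"
    by auto
  have idx: "C_index \<phi> (s e)" "C_set \<phi> (s e) = language e" for e
    by (auto simp: C_index_def C_set_def \<phi>)
  \<comment> \<open>Bit 0 of a set code tells whether 0 is in the set; all codes of sets without 0 are merged
    into 0, so that the hypothesis does not change before 0 appears.\<close>
  define h where "h e = Some (s (if e mod 2 = 0 then 0 else e))" for e
  have "recursive 1 (\<lambda>xs. s (if xs ! 0 mod 2 = 0 then 0 else xs ! 0))"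
    by (rule recursive_comp1[OF s[unfolded total_computable_iff]])
      (intro recursive_if_zero recursive_mod_2 recursive_proj; simp)
  then have h_computable: "partial_computable h"
    unfolding h_def[abs_def] total_computable_def[symmetric] by (simp add: total_computable_iff)
  have h_encode: "h (set_encode S) = Some (s (if 0 \<in> S then set_encode S else 0))"
    if "finite S" for S
    using that set_decode_0[of "set_encode S"] by (auto simp: h_def even_iff_mod_2_eq_zero)
  have "CInd \<phi> (Sd h T) T" for T
    by (simp add: CInd_def Sd_def h_def idx)
  moreover have "Ex_C \<phi> (Sd h T) T" if "content T \<in> separating_class" for T
  proof (cases "content T = {0<..}")
    case True
    have "0 \<notin> list_content (initial T i)" for i
    proof
      assume "0 \<in> list_content (initial T i)"
      then have "0 \<in> content T"
        by (auto simp: mem_list_content_initial mem_content)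
      then show False using True by simp
    qed
    then have "Sd h T i = Some (s 0)" for i
      by (simp add: Sd_def h_encode finite_list_content)
    then show ?thesis
      by (auto simp: Ex_C_def idx language_def True)
  next
    case False
    then have fin: "finite (content T)" "0 \<in> content T"
      using that by (auto simp: separating_class_def)
    obtain n where "\<forall>i\<ge>n. list_content (initial T i) = content T"
      using list_content_initial_eventually[OF fin(1)] by blast
    then have "\<forall>i\<ge>n. Sd h T i = Some (s (set_encode (content T)))"
      using fin by (simp add: Sd_def h_encode)
    moreover have "language (set_encode (content T)) = content T"
      using fin by (rule language_set_encode)
    ultimately show ?thesis
      unfolding Ex_C_def by (metis idx order_refl)
  qed
  ultimately show ?thesis
    using separating_class_subset_REC h_computable
    by (auto simp: learnable_REC_def learns_def text_for_def)
qed


section \<open>Iterative learners fail\<close>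

lemma It_cong: "(\<And>j. j < i \<Longrightarrow> T j = T' j) \<Longrightarrow> It h T i = It h T' i"
  by (induction i) auto

text \<open>The current hypothesis is the only memory: equal hypotheses followed by equal data
  evolve equally, even if reached at different times.\<close>

lemma It_add_cong:
  assumes "It h T m = It h T' n" "\<And>k. T (m + k) = T' (n + k)"
  shows "It h T (m + k) = It h T' (n + k)"
  using assms by (induction k) auto

lemma Ex_W_shift_content_eq:
  assumes "Ex_W \<phi> p T" "Ex_W \<phi> q T'" "\<And>k. p (m + k) = q (n + k)"
  shows "content T = content T'"
proof -
  obtain a d where a: "\<And>i. i \<ge> a \<Longrightarrow> p i = Some d" "W_set \<phi> d = content T"
    using assms(1) unfolding Ex_W_def by metis
  obtain b e where b: "\<And>i. i \<ge> b \<Longrightarrow> q i = Some e" "W_set \<phi> e = content T'"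
    using assms(2) unfolding Ex_W_def by metis
  \<comment> \<open>Offset \<open>a + b\<close> lies past both points of convergence, whatever the
    shifts \<open>m\<close> and \<open>n\<close> are.\<close>
  have "d = e"
    using a(1)[of "m + (a + b)"] b(1)[of "n + (a + b)"] assms(3)[of "a + b"] by simp
  with a b show ?thesis by simp
qed

lemma separating_class_not_It_learnable:
  "separating_class \<notin> learnable_REC Unrestricted It (Ex_W \<phi>)"
proof
  assume "separating_class \<in> learnable_REC Unrestricted It (Ex_W \<phi>)"
  then obtain h where "\<forall>L\<in>separating_class. learns Unrestricted It (Ex_W \<phi>) h L"
    by (auto simp: learnable_REC_def)
  then have h: "Ex_W \<phi> (It h T) T" if "content T \<in> separating_class" for T
    using that by (simp add: learns_def text_for_def)
  define T where "T i = Some (Suc i)" for i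
  \<comment> \<open>\<open>U n\<close> follows \<open>T\<close> through 1, ..., \<open>n\<close> and
    then shows only 0, which puts its content into the class.\<close>
  define U where "U n i = (if i < n then Some (Suc i) else Some 0)" for n i :: nat
  have "content T = {0<..}"
    by (auto simp: set_eq_iff mem_content T_def gr0_conv_Suc)
  then have "Ex_W \<phi> (It h T) T"
    by (simp add: h separating_class_def)
  then obtain n where "\<forall>i\<ge>n. It h T i = It h T n"
    unfolding Ex_W_def by blast
  \<comment> \<open>The datum read here is \<open>T n = Some (Suc n)\<close>; it leaves no trace in
    the hypothesis.\<close>
  then have n: "It h T (Suc n) = It h T n"
    by (meson le_SucI order_refl)
  have content_U: "content (U m) = {..m}" for m
  proof
    show "content (U m) \<subseteq> {..m}"
      by (auto simp: mem_content U_def split: if_splits)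
    have "U m (if x = 0 then m else x - 1) = Some x" if "x \<le> m" for x
      using that by (auto simp: U_def)
    then show "{..m} \<subseteq> content (U m)"
      unfolding subset_eq mem_content atMost_iff by blast
  qed
  then have Ex: "Ex_W \<phi> (It h (U m)) (U m)" for m
    by (simp add: h separating_class_def)
  have "It h (U m) m = It h T m" for m
    by (rule It_cong) (simp add: U_def T_def)
  \<comment> \<open>The two runs meet one step apart, just before each text turns to 0 forever; from
    there on they see the same data.\<close>
  then have eq: "It h (U n) n = It h (U (Suc n)) (Suc n)"
    using n by metis
  have "It h (U n) (n + k) = It h (U (Suc n)) (Suc n + k)" for k
    by (rule It_add_cong[OF eq]) (simp add: U_def)
  with Ex Ex have "content (U n) = content (U (Suc n))"
    by (rule Ex_W_shift_content_eq)
  then show False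
    by (simp add: content_U)
qed

theorem theorem12:
  fixes \<phi> :: "nat \<Rightarrow> nat \<Rightarrow> nat option"
  assumes "acceptable_numbering \<phi>"
  shows "learnable_REC (CInd \<phi>) Sd (Ex_C \<phi>) - learnable_REC Unrestricted It (Ex_W \<phi>) \<noteq> {}"
  using DiffI[OF separating_class_Sd_learnable[OF assms] separating_class_not_It_learnable]
  by (metis empty_iff)

end
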